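(* Let $A\in\mathbb{R}^{N\times N}$ satisfy the standing assumptions given in the context, and let $\tfrac38\le\gamma\le\tfrac34$. 1. Let $y^*>0$ be a positive steady state of the differential equation $y'=Ay$, i.e. $Ay^*=0$. Then $y^*$ is a (Lyapunov) stable fixed point of the MPRK43($\gamma$) scheme applied to $y'=Ay$ for all $\Delta t>0$. 2. Let $y^*>0$ be the unique steady state of the initial value problem $y'=Ay$, $y(0)=y^0>0$. Then, for all $\Delta t>0$, the MPRK43($\gamma$) iterates started at $y^0$ converge to $y^*$ if $y^0$ is close enough to $y^*$; that is, for each $\Delta t>0$ there is a $\delta>0$ such that $\|y^0-y^*\|<\delta$ implies $y^n\to y^*$ as $n\to\infty$.
   Context: Inequalities between vectors are componentwise; $\operatorname{diag}(v)$ is the diagonal matrix with diagonal $v$, and real powers of positive diagonal matrices are taken entrywise on the diagonal. Standing assumptions on $A\in\mathbb{R}^{N\times N}$: $A\ne 0$; all off-diagonal entries of $A$ are nonnegative; $(1,\dots,1)^T\in\ker(A^T)$; the eigenvalue $0$ of $A$ has equal algebraic and geometric multiplicity $k\ge 1$; every eigenvalue $\lambda$ of $A$ satisfies $\operatorname{Re}(\lambda)\le 0$. Steady state of the initial value problem: the unique vector $y^*$ with $Ay^*=0$ and $n^Ty^*=n^Ty^0$ for all $n\in\ker(A^T)$. The MPRK43($\gamma$) scheme: put $a_{21}=\tfrac23$, $a_{31}=\tfrac23-\tfrac1{4\gamma}$, $a_{32}=\tfrac1{4\gamma}$, $b_1=\tfrac14$, $b_2=\tfrac34-\gamma$, $b_3=\gamma$,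 $p=\tfrac43\gamma$, $q=\tfrac23$, $\beta_1=\tfrac14$, $\beta_2=\tfrac34$. With step size $\Delta t>0$, applied to $y'=Ay$ (written as a production-destruction system with $p_{ij}(y)=d_{ji}(y)=a_{ij}y_j$ for $i\neq j$, where here $a_{ij}$ are the entries of $A$, and $p_{ii}=d_{ii}=0$), it maps $y^n>0$ to $y^{n+1}=g(y^n)$ by successively solving the linear systems $$y^{(1)}=y^n+a_{21}\Delta t\,A\,y^{(1)},$$ $$y^{(2)}=y^n+\Delta t\,A\operatorname{diag}(y^{(2)})\operatorname{diag}(y^{(1)})^{-1/p}\operatorname{diag}(y^n)^{1/p-1}\left(a_{31}y^n+a_{32}y^{(1)}\right),$$ $$y^{(3)}=y^n+\Delta t\,A\operatorname{diag}(y^{(3)})\operatorname{diag}(y^{(1)})^{-1/q}\operatorname{diag}(y^n)^{1/q-1}\left(\beta_1y^n+\beta_2y^{(1)}\right),$$ $$y^{n+1}=y^n+\Delta t\,A\operatorname{diag}(y^{n+1})\operatorname{diag}(y^{(3)})^{-1}\left(b_1y^n+b_2y^{(1)}+b_3y^{(2)}\right).$$ A fixed point $y^*=g(y^* )$ of the iteration $y^{n+1}=g(y^n)$ is (Lyapunov) stable if for every $\epsilon>0$ there is $\delta>0$ such that $\|y^0-y^*\|<\delta$ implies $\|y^n-y^*\|<\epsilon$ for all $n\ge 0$. *)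

theory Defs
  imports "HOL-Analysis.Analysis" "HOL-Computational_Algebra.Polynomial"
begin

text \<open>The order on \<^typ>\<open>real ^ 'n\<close> has \<open>0 < v\<close> iff \<open>0 \<le> v\<close> and \<open>v \<noteq> 0\<close>, which is weaker than
  the componentwise strict inequality used here.\<close>

definition positive_vec :: "real ^ 'n \<Rightarrow> bool" where
  "positive_vec v \<longleftrightarrow> (\<forall>i. 0 < v $ i)"

definition diag :: "real ^ 'n \<Rightarrow> real ^ 'n ^ 'n" where
  "diag v = (\<chi> i j. if i = j then v $ i else 0)"

text \<open>\<open>diag_powr v r\<close> is \<open>diag(v)\<^sup>r\<close>, for positive \<open>v\<close>.\<close>

definition diag_powr :: "real ^ 'n \<Rightarrow> real \<Rightarrow> real ^ 'n ^ 'n" where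
  "diag_powr v r = diag (\<chi> i. v $ i powr r)"

definition charpoly :: "'a::comm_ring_1 ^ 'n ^ 'n \<Rightarrow> 'a poly" where
  "charpoly A = det (mat [:0, 1:] - map_matrix (\<lambda>a. [:a:]) A)"

definition algebraic_multiplicity :: "real ^ 'n ^ 'n \<Rightarrow> real \<Rightarrow> nat" where
  "algebraic_multiplicity A l = order l (charpoly A)"

definition geometric_multiplicity :: "real ^ 'n ^ 'n \<Rightarrow> real \<Rightarrow> nat" where
  "geometric_multiplicity A l = dim {v. A *v v = l *\<^sub>R v}"

text \<open>Eigenvalues of a real matrix are taken over the complex numbers.\<close>

definition complex_eigenvalue :: "real ^ 'n ^ 'n \<Rightarrow> complex \<Rightarrow> bool" where
  "complex_eigenvalue A l \<longleftrightarrow>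
     (\<exists>v :: complex ^ 'n. v \<noteq> 0 \<and> map_matrix complex_of_real A *v v = l *s v)"

text \<open>In \<open>transpose A *v 1 = 0\<close> the \<open>1\<close> is the vector \<open>(1,\<dots>,1)\<close>.\<close>

definition standing_assumptions :: "real ^ 'n ^ 'n \<Rightarrow> bool" where
  "standing_assumptions A \<longleftrightarrow>
     A \<noteq> 0 \<and>
     (\<forall>i j. i \<noteq> j \<longrightarrow> 0 \<le> A $ i $ j) \<and>
     transpose A *v 1 = 0 \<and>
     (\<exists>k\<ge>1. algebraic_multiplicity A 0 = k \<and> geometric_multiplicity A 0 = k) \<and>
     (\<forall>l. complex_eigenvalue A l \<longrightarrow> Re l \<le> 0)"

text \<open>\<open>ivp_steady_state A y0 ys\<close>: the vector \<open>ys\<close> is the steady state of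
  \<open>y' = A y\<close>, \<open>y(0) = y0\<close>. Under the standing assumptions exactly one such \<open>ys\<close> exists, because
  equality of the two multiplicities of \<open>0\<close> makes \<open>\<real>\<^sup>n\<close> the direct sum of the
  kernel and the range of \<open>A\<close>.\<close>

definition ivp_steady_state :: "real ^ 'n ^ 'n \<Rightarrow> real ^ 'n \<Rightarrow> real ^ 'n \<Rightarrow> bool" where
  "ivp_steady_state A y0 ys \<longleftrightarrow>
     A *v ys = 0 \<and> (\<forall>n. transpose A *v n = 0 \<longrightarrow> n \<bullet> ys = n \<bullet> y0)"

text \<open>One step of MPRK43(\<open>\<gamma>\<close>) with step size \<open>dt\<close>. Each \<open>THE\<close> denotes the solution of a square
  linear system. For a positive \<open>y\<close>, \<open>dt > 0\<close>, \<open>3/8 \<le> \<gamma> \<le> 3/4\<close> and \<open>A\<close> with nonnegative off-diagonal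
  entries and zero column sums, each of these systems has exactly one solution and it is positive: the
  transposed system matrix is strictly diagonally dominant with nonpositive off-diagonal
  entries. No meaning is attached to the value at a nonpositive \<open>y\<close>.\<close>

definition mprk43 :: "real \<Rightarrow> real \<Rightarrow> real ^ 'n ^ 'n \<Rightarrow> real ^ 'n \<Rightarrow> real ^ 'n" where
  "mprk43 \<gamma> dt A y = (let
     a21 = 2 / 3;
     a31 = 2 / 3 - 1 / (4 * \<gamma>);
     a32 = 1 / (4 * \<gamma>);
     b1 = 1 / 4;
     b2 = 3 / 4 - \<gamma>;
     b3 = \<gamma>;
     p = 4 / 3 * \<gamma>;
     q = 2 / 3;
     \<beta>1 = 1 / 4;
     \<beta>2 = 3 / 4;
     y1 = (THE x. x = y + (a21 * dt) *\<^sub>R (A *v x));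
     y2 = (THE x. x = y + dt *\<^sub>R
             ((A ** diag x ** diag_powr y1 (- 1 / p) ** diag_powr y (1 / p - 1))
                *v (a31 *\<^sub>R y + a32 *\<^sub>R y1)));
     y3 = (THE x. x = y + dt *\<^sub>R
             ((A ** diag x ** diag_powr y1 (- 1 / q) ** diag_powr y (1 / q - 1))
                *v (\<beta>1 *\<^sub>R y + \<beta>2 *\<^sub>R y1)))
   in (THE x. x = y + dt *\<^sub>R
             ((A ** diag x ** diag_powr y3 (- 1))
                *v (b1 *\<^sub>R y + b2 *\<^sub>R y1 + b3 *\<^sub>R y2))))"

definition lyapunov_stable_fixed_point ::
    "('a::real_normed_vector \<Rightarrow> 'a) \<Rightarrow> 'a \<Rightarrow> bool" where
  "lyapunov_stable_fixed_point g ys \<longleftrightarrow>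
     g ys = ys \<and>
     (\<forall>\<epsilon>>0. \<exists>\<delta>>0. \<forall>y0. norm (y0 - ys) < \<delta> \<longrightarrow> (\<forall>n. norm ((g ^^ n) y0 - ys) < \<epsilon>))"

end

theory Submission
  imports Defs "HOL-Library.Landau_Symbols"
begin

text \<open>Put \<open>X = dt A\<close>. Because \<open>X\<close> has nonnegative off-diagonal entries, zero column sums and a positive
kernel vector \<open>ys\<close>, it is dissipative for the inner product with weights \<open>1 / ys\<^sub>i\<close>
(\<open>dissipative\<close>): this is the Dirichlet form of a Markov chain with stationary measure \<open>ys\<close>.
Dissipativity makes kernel and range of \<open>X\<close> orthogonal for that inner product, so space splits as
kernel plus range; let \<open>P\<close> be the projection on the kernel (\<open>kernel_projection\<close>).

Every stage changes its input \<open>y\<close> by an element of the range, so \<open>P\<close> is invariant under the scheme,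
and positive kernel vectors are fixed points. Hence the dynamics can be studied separately in each
fibre of \<open>P\<close>, where the fixed point \<open>P y\<close> is to attract the point \<open>y\<close>. It suffices to expand one
step to first order in \<open>y - P y\<close>, uniformly near \<open>ys\<close>. For each of the linearly implicit
stages this is done by \<open>stage_expansion\<close>; the nonlinear Patankar weights contribute only through
their derivative at ratio \<open>1\<close> (\<open>powr_weight_expansion\<close>, \<open>ratio_expansion\<close>). The outcome
(\<open>mprk43_map_expansion\<close>) is that the linear part is \<open>R(X)\<close> with
\<open>R(z) = (1 - 7/3 z + 23/18 z\<^sup>2 + 7/18 z\<^sup>3 - 5/18 z\<^sup>4) / ((1 - z)\<^sup>2 (1 - 2/3 z)\<^sup>2)\<close>
in which \<open>\<gamma>\<close> cancels.

On the imaginary axis the denominator \<open>d\<close> and the numerator \<open>n\<close> of \<open>R\<close> satisfy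
\<open>324 (|d(i t)|\<^sup>2 - |n(i t)|\<^sup>2) = 27 t\<^sup>4 + 137 t\<^sup>6 + 39 t\<^sup>8\<close>. A sum-of-squares form of this identity
turns dissipativity of \<open>X\<close>, which is in general not normal, into strict contractivity of
\<open>R(X)\<close> on the range of \<open>X\<close> in the weighted norm (\<open>stability_function_certificate\<close>,
\<open>stability_function_contracts_range\<close>). By compactness the contraction has a rate below \<open>1\<close>, which absorbs the higher-order terms near \<open>ys\<close>; stability and convergence to \<open>P y\<^sub>0\<close> follow
(\<open>contraction_towards_projection\<close>). Finally \<open>P y\<^sub>0\<close> is the steady state of the initial value problem
since the linear invariants of \<open>X\<close> separate the points of its kernel (\<open>P_steady_state\<close>).\<close>

section \<open>Equilibria of Markov generators\<close>

locale weighted_generator =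
  fixes X :: "real ^ 'n ^ 'n" and ys :: "real ^ 'n"
  assumes offdiag: "\<And>i j. i \<noteq> j \<Longrightarrow> 0 \<le> X $ i $ j"
    and colsum: "\<And>j. (\<Sum>i\<in>UNIV. X $ i $ j) = 0"
    and equilibrium: "X *v ys = 0"
    and pos: "\<And>i. 0 < ys $ i"
begin

text \<open>\<open>scaled u \<bullet> scaled v\<close> is the inner product with weights \<open>1 / ys $ i\<close>; writing it through a scaling
makes the norm inequalities of the standard inner product applicable.\<close>

definition scaled :: "real ^ 'n \<Rightarrow> real ^ 'n" where
  "scaled v = (\<chi> i. v $ i / sqrt (ys $ i))"

lemma linear_scaled: "linear scaled"
  by (rule linearI) (simp_all add: scaled_def vec_eq_iff add_divide_distrib)

lemmas scaled_simps = linear_add[OF linear_scaled] linear_diff[OF linear_scaled] linear_scale[OF linear_scaled]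
  linear_0[OF linear_scaled] linear_neg[OF linear_scaled]

lemma scaled_eq_0_iff [simp]: "scaled v = 0 \<longleftrightarrow> v = 0"
  using pos by (auto simp: scaled_def vec_eq_iff less_imp_neq[THEN not_sym])

text \<open>With \<open>u = v / ys\<close> and \<open>B i j = X $ i $ j * ys $ j\<close>, the left side is the quadratic form
\<open>\<Sum>i j. B i j u\<^sub>i u\<^sub>j\<close>. All row and column sums of \<open>B\<close> vanish, so the form equals
\<open>- (\<Sum>i j. B i j (u\<^sub>i - u\<^sub>j)\<^sup>2) / 2\<close>, where the diagonal entries drop out.\<close>

lemma dissipative: "scaled v \<bullet> scaled (X *v v) \<le> 0"
proof -
  define u where "u i = v $ i / ys $ i" for i
  define B where "B i j = X $ i $ j * ys $ j" for i j
  have v: "v $ i = u i * ys $ i" for i using pos[of i] by (simp add: u_def)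
  have row: "(\<Sum>j\<in>UNIV. B i j) = 0" for i
    using equilibrium by (simp add: B_def vec_eq_iff matrix_vector_mult_def)
  have col: "(\<Sum>i\<in>UNIV. B i j) = 0" for j
    using colsum[of j] by (simp add: B_def flip: sum_distrib_right)
  have r2: "(\<Sum>i\<in>UNIV. \<Sum>j\<in>UNIV. B i j * (u i)\<^sup>2) = 0"
    by (simp add: row flip: sum_distrib_right)
  have c2: "(\<Sum>i\<in>UNIV. \<Sum>j\<in>UNIV. B i j * (u j)\<^sup>2) = 0"
    by (subst sum.swap) (simp add: col flip: sum_distrib_right)
  have "scaled v $ i * scaled (X *v v) $ i = (\<Sum>j\<in>UNIV. B i j * (u i * u j))" for i
  proof -
    have "scaled v $ i * scaled (X *v v) $ i = (v $ i * (X *v v) $ i) / (sqrt (ys $ i) * sqrt (ys $ i))"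
      by (simp add: scaled_def)
    also have "\<dots> = u i * (X *v v) $ i"
      using pos[of i] by (simp add: u_def)
    also have "\<dots> = (\<Sum>j\<in>UNIV. B i j * (u i * u j))"
      by (simp add: matrix_vector_mult_def sum_distrib_left B_def v mult_ac)
    finally show ?thesis .
  qed
  then have "scaled v \<bullet> scaled (X *v v) = (\<Sum>i\<in>UNIV. \<Sum>j\<in>UNIV. B i j * (u i * u j))"
    by (simp add: inner_vec_def)
  also have "\<dots> = (\<Sum>i\<in>UNIV. \<Sum>j\<in>UNIV.
      B i j * (u i)\<^sup>2 / 2 + B i j * (u j)\<^sup>2 / 2 - B i j * (u i - u j)\<^sup>2 / 2)"
    by (intro sum.cong refl) (simp add: power2_eq_square field_simps)
  also have "\<dots> = - (\<Sum>i\<in>UNIV. \<Sum>j\<in>UNIV. B i j * (u i - u j)\<^sup>2) / 2"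
    using r2 c2 by (simp add: sum.distrib sum_subtractf flip: sum_divide_distrib)
  also have "\<dots> \<le> 0"
  proof -
    have "0 \<le> B i j * (u i - u j)\<^sup>2" for i j
      by (cases "i = j") (auto simp: B_def offdiag pos less_imp_le)
    then show ?thesis by (simp add: sum_nonneg)
  qed
  finally show ?thesis .
qed

text \<open>On the line \<open>x + t u\<close> through \<open>x\<close> in the direction of a kernel vector \<open>u\<close>, the dissipation is affine in \<open>t\<close>;
being bounded above, it has slope zero.\<close>

lemma kernel_orthogonal_range:
  assumes "X *v u = 0" shows "scaled u \<bullet> scaled (X *v x) = 0"
proof (rule ccontr)
  assume b: "scaled u \<bullet> scaled (X *v x) \<noteq> 0"
  define t where "t = (1 - scaled x \<bullet> scaled (X *v x)) / (scaled u \<bullet> scaled (X *v x))"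
  have "scaled (t *\<^sub>R u + x) \<bullet> scaled (X *v (t *\<^sub>R u + x)) \<le> 0" by (rule dissipative)
  moreover have "X *v (t *\<^sub>R u + x) = X *v x"
    using assms by (simp add: matrix_vector_right_distrib matrix_vector_mult_scaleR)
  ultimately have "t * (scaled u \<bullet> scaled (X *v x)) + scaled x \<bullet> scaled (X *v x) \<le> 0"
    by (simp add: scaled_simps inner_simps)
  with b show False by (simp add: t_def)
qed

lemma kernel_Int_range:
  assumes "X *v u = 0" "u \<in> range ((*v) X)" shows "u = 0"
  using kernel_orthogonal_range[OF assms(1)] assms(2) by (metis scaled_eq_0_iff imageE inner_eq_zero_iff)

text \<open>This gives invertibility of the implicit stages at the equilibrium, whose weights are constants \<open>c\<close>.\<close>

lemma inj_resolvent:
  assumes "0 \<le> c" shows "inj (\<lambda>v. v - c *\<^sub>R (X *v v))"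
proof -
  have lin: "linear (\<lambda>v. v - c *\<^sub>R (X *v v))"
    by (intro linear_compose_sub linear_id[unfolded id_def] linear_compose_scale_right) simp
  show ?thesis
    unfolding linear_injective_0[OF lin]
  proof safe
    fix v assume "v - c *\<^sub>R (X *v v) = 0"
    then have "scaled v \<bullet> scaled v = c * (scaled v \<bullet> scaled (X *v v))"
      by (metis scaled_simps(3) eq_iff_diff_eq_0 inner_scaleR_right)
    also have "\<dots> \<le> 0" using assms dissipative by (simp add: mult_nonneg_nonpos)
    finally show "v = 0" by (metis scaled_eq_0_iff inner_eq_zero_iff inner_ge_zero order_antisym)
  qed
qed

lemma scaled_bounds:
  obtains C where "0 < C" "\<And>v. norm v \<le> C * norm (scaled v)" "\<And>v. norm (scaled v) \<le> C * norm v"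
proof -
  obtain B where B: "B > 0" "\<And>v. norm (scaled v) \<le> B * norm v"
    using linear_bounded_pos[OF linear_scaled] by metis
  have "inj scaled" using scaled_eq_0_iff linear_injective_0[OF linear_scaled] by blast
  then obtain b where b: "b > 0" "\<And>v. b * norm v \<le> norm (scaled v)"
    using linear_inj_bounded_below_pos[OF linear_scaled] by metis
  have "norm v \<le> (B + 1 / b) * norm (scaled v)" for v
  proof -
    have "norm v \<le> 1 / b * norm (scaled v)" using b(2)[of v] b(1) by (simp add: field_simps)
    moreover have "0 \<le> B * norm (scaled v)" using B(1) by simp
    ultimately show ?thesis by (simp add: distrib_right)
  qed
  moreover have "norm (scaled v) \<le> (B + 1 / b) * norm v" for v
  proof -
    have "0 \<le> 1 / b * norm v" using b(1) by simp
    then show ?thesis using B(2)[of v] by (simp add: distrib_right)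
  qed
  moreover have "0 < B + 1 / b" using B(1) b(1) by (simp add: add_pos_pos)
  ultimately show thesis using that by blast
qed

text \<open>Kernel and range meet only in \<open>0\<close>, so \<open>X\<close> is injective on its range and maps it onto itself. Hence
\<open>X y = X r\<close> for some \<open>r\<close> in the range, and \<open>y - r\<close> is the kernel component of \<open>y\<close>.\<close>

lemma kernel_projection:
  obtains P where "linear P" "\<And>y. X *v P y = 0" "\<And>y. y - P y \<in> range ((*v) X)"
proof -
  let ?R = "range ((*v) X)"
  have sub: "subspace ?R" by (simp add: linear_subspace_image)
  have inj: "inj_on ((*v) X) ?R"
  proof (rule inj_onI)
    fix a b assume ab: "a \<in> ?R" "b \<in> ?R" "X *v a = X *v b"
    then have "a - b = 0"
      using subspace_diff[OF sub] by (intro kernel_Int_range[of "a - b"]) (simp_all add: matrix_vector_mult_diff_distrib)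
    then show "a = b" by simp
  qed
  have "(*v) X ` ?R = ?R"
  proof (rule subspace_dim_equal)
    show "dim ?R \<le> dim ((*v) X ` ?R)"
      using dim_image_eq[of "(*v) X" ?R] inj sub by (simp add: span_eq_iff[THEN iffD2])
  qed (auto simp: linear_subspace_image sub)
  then have "\<exists>z. X *v z = 0 \<and> y - z \<in> ?R" for y
  proof -
    assume *: "(*v) X ` ?R = ?R"
    have "X *v y \<in> (*v) X ` ?R" unfolding * by simp
    then obtain r where "r \<in> ?R" "X *v y = X *v r" by auto
    then show ?thesis
      by (intro exI[of _ "y - r"]) (simp add: matrix_vector_mult_diff_distrib)
  qed
  then obtain P where P: "\<And>y. X *v P y = 0" "\<And>y. y - P y \<in> ?R" by metis
  have uniq: "P y = z" if "X *v z = 0" "y - z \<in> ?R" for y z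
  proof -
    have "(y - z) - (y - P y) \<in> ?R" using that(2) P(2) sub by (rule subspace_diff[rotated])
    then have "P y - z = 0"
      using that P by (intro kernel_Int_range[of "P y - z"]) (simp_all add: matrix_vector_mult_diff_distrib)
    then show ?thesis by simp
  qed
  have "linear P"
  proof (rule linearI)
    fix a b :: "real ^ 'n" and r :: real
    have "(a - P a) + (b - P b) \<in> ?R" using P sub subspace_add by blast
    then show "P (a + b) = P a + P b"
      by (intro uniq) (simp_all add: P matrix_vector_right_distrib algebra_simps)
    have "r *\<^sub>R (a - P a) \<in> ?R" using P sub subspace_scale by blast
    then show "P (r *\<^sub>R a) = r *\<^sub>R P a"
      by (intro uniq) (simp_all add: P matrix_vector_mult_scaleR scaleR_diff_right)
  qed
  then show thesis using that P by blast
qed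

end

section \<open>Componentwise asymptotics\<close>

lemma derivative_remainder_smallo:
  fixes f :: "real \<Rightarrow> real"
  assumes "(f has_real_derivative s) (at a)"
  shows "(\<lambda>t. f (a + t) - f a - s * t) \<in> o[nhds 0](\<lambda>t. t)"
proof (rule landau_o.smallI)
  fix c :: real assume "c > 0"
  then obtain d where "d > 0" "\<And>y. norm (y - a) < d \<Longrightarrow> norm (f y - f a - s * (y - a)) \<le> c * norm (y - a)"
    using assms unfolding has_field_derivative_def has_derivative_within_alt by blast
  then show "\<forall>\<^sub>F t in nhds 0. norm (f (a + t) - f a - s * t) \<le> c * norm t"
    unfolding eventually_nhds_metric by (metis add_diff_cancel_left' dist_norm diff_zero)
qed

lemma norm_smallo_vec:
  fixes f :: "'a \<Rightarrow> real ^ 'n"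
  assumes "\<And>i. (\<lambda>y. f y $ i) \<in> o[F](g)" shows "(\<lambda>y. norm (f y)) \<in> o[F](g)"
proof -
  have "(\<lambda>y. norm (f y)) \<in> O[F](\<lambda>y. \<Sum>i\<in>UNIV. \<bar>f y $ i\<bar>)"
    using norm_le_l1_cart by (intro bigoI[of _ 1] always_eventually) (auto intro: order_trans)
  also have "(\<lambda>y. \<Sum>i\<in>UNIV. \<bar>f y $ i\<bar>) \<in> o[F](g)"
    using assms by (intro big_sum_in_smallo) simp
  finally show ?thesis .
qed

lemma norm_bigo_vec:
  fixes f :: "'a \<Rightarrow> real ^ 'n"
  assumes "\<And>i. (\<lambda>y. f y $ i) \<in> O[F](g)" shows "(\<lambda>y. norm (f y)) \<in> O[F](g)"
proof -
  have "(\<lambda>y. norm (f y)) \<in> O[F](\<lambda>y. \<Sum>i\<in>UNIV. \<bar>f y $ i\<bar>)"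
    using norm_le_l1_cart by (intro bigoI[of _ 1] always_eventually) (auto intro: order_trans)
  also have "(\<lambda>y. \<Sum>i\<in>UNIV. \<bar>f y $ i\<bar>) \<in> O[F](g)"
    using assms by (intro big_sum_in_bigo) simp
  finally show ?thesis .
qed

lemma nth_smallo_vec:
  fixes f :: "'a \<Rightarrow> real ^ 'n"
  assumes "(\<lambda>y. norm (f y)) \<in> o[F](g)" shows "(\<lambda>y. f y $ i) \<in> o[F](g)"
  by (rule landau_o.big_small_trans[OF _ assms], rule bigoI[of _ 1], rule always_eventually)
     (simp add: component_le_norm_cart)

lemma norm_hadamard_le:
  fixes x e :: "real ^ 'n"
  shows "norm (\<chi> i. x $ i * e $ i) \<le> norm x * norm e"
proof -
  have "norm (\<chi> i. x $ i * e $ i) \<le> norm (norm e *\<^sub>R x)"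
    by (rule norm_le_componentwise_cart)
       (simp add: abs_mult mult.commute mult_right_mono component_le_norm_cart)
  then show ?thesis by (simp add: mult.commute)
qed

section \<open>First-order expansion of the implicit stages\<close>

text \<open>Every stage of the scheme has this form: the vector \<open>c\<close> collects the Patankar weights by which the
components of the unknown are multiplied.\<close>

definition stage :: "real ^ 'n ^ 'n \<Rightarrow> real ^ 'n \<Rightarrow> real ^ 'n \<Rightarrow> real ^ 'n" where
  "stage X y c = (THE x. x = y + X *v (\<chi> i. x $ i * c $ i))"

locale split_generator = weighted_generator X ys
  for X :: "real ^ 'n ^ 'n" and ys :: "real ^ 'n" +
  fixes P :: "real ^ 'n \<Rightarrow> real ^ 'n"
  assumes linear_P: "linear P" and X_P [simp]: "X *v P y = 0" and P_range: "y - P y \<in> range ((*v) X)"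
begin

definition defect :: "real ^ 'n \<Rightarrow> real" where "defect y = norm (y - P y)"

text \<open>A first-order expansion at all positive equilibria near \<open>ys\<close> simultaneously: the base point \<open>P y\<close> moves
with \<open>y\<close>, and the error is small relative to the distance \<open>defect y\<close> from that base point, not to the
distance from \<open>ys\<close>. In particular \<open>f\<close> fixes kernel vectors close to \<open>ys\<close>, where \<open>defect\<close> vanishes.\<close>

definition expands :: "(real ^ 'n \<Rightarrow> real ^ 'n) \<Rightarrow> (real ^ 'n \<Rightarrow> real ^ 'n) \<Rightarrow> bool" where
  "expands f D \<longleftrightarrow> linear D \<and> (\<forall>i. (\<lambda>y. f y $ i - P y $ i - D (y - P y) $ i) \<in> o[nhds ys](defect))"

lemma P_ys: "P ys = ys"
proof -
  have "ys - P ys = 0"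
    by (rule kernel_Int_range) (simp_all add: matrix_vector_mult_diff_distrib equilibrium P_range)
  then show ?thesis by simp
qed

lemma P_X: "P (X *v x) = 0"
proof (rule kernel_Int_range)
  have "subspace (range ((*v) X))" by (simp add: linear_subspace_image)
  from subspace_diff[OF this, of "X *v x" "X *v x - P (X *v x)"]
  show "P (X *v x) \<in> range ((*v) X)" using P_range by simp
qed simp

lemma tendsto_P: "(P \<longlongrightarrow> ys) (nhds ys)"
  using linear_continuous_at[OF linear_conv_bounded_linear[THEN iffD1, OF linear_P], of ys]
  by (metis P_ys continuous_within tendsto_at_iff_tendsto_nhds)

lemma tendsto_P_nth: "((\<lambda>y. P y $ i) \<longlongrightarrow> ys $ i) (nhds ys)"
  by (intro tendsto_intros tendsto_P)

lemma defect_tendsto: "(defect \<longlongrightarrow> 0) (nhds ys)"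
proof -
  have "((\<lambda>y. norm (y - P y)) \<longlongrightarrow> norm (ys - ys)) (nhds ys)"
    by (intro tendsto_intros tendsto_P filterlim_ident)
  then show ?thesis by (simp add: defect_def[abs_def])
qed

lemma bigo_defect_tendsto:
  assumes "f \<in> O[nhds ys](defect)" shows "(f \<longlongrightarrow> (0::real)) (nhds ys)"
proof -
  obtain c where "eventually (\<lambda>y. norm (f y) \<le> c * norm (defect y)) (nhds ys)"
    using assms by (rule landau_o.bigE)
  moreover have "((\<lambda>y. c * norm (defect y)) \<longlongrightarrow> c * norm (0::real)) (nhds ys)"
    by (intro tendsto_intros defect_tendsto)
  ultimately show ?thesis by (intro Lim_null_comparison[of f]) auto
qed

lemma tendsto_0_mult_bigo:
  assumes "(f \<longlongrightarrow> (0::real)) (nhds ys)" "g \<in> O[nhds ys](defect)"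
  shows "(\<lambda>y. f y * g y) \<in> o[nhds ys](defect)"
proof -
  have "f \<in> o[nhds ys](\<lambda>_. 1)" using assms(1) by (intro smalloI_tendsto) simp_all
  from landau_o.small_big_mult[OF this assms(2)] show ?thesis by simp
qed

lemma bounded_mult_smallo:
  assumes "(f \<longlongrightarrow> (l::real)) (nhds ys)" "g \<in> o[nhds ys](defect)"
  shows "(\<lambda>y. f y * g y) \<in> o[nhds ys](defect)"
proof -
  have "f \<in> O[nhds ys](\<lambda>_. 1)" using assms(1) by (intro bigoI_tendsto[of _ _ l]) simp_all
  from landau_o.big_small_mult[OF this assms(2)] show ?thesis by simp
qed

lemma bounded_mult_bigo:
  assumes "(f \<longlongrightarrow> (l::real)) (nhds ys)" "g \<in> O[nhds ys](defect)"
  shows "(\<lambda>y. f y * g y) \<in> O[nhds ys](defect)"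
proof -
  have "f \<in> O[nhds ys](\<lambda>_. 1)" using assms(1) by (intro bigoI_tendsto[of _ _ l]) simp_all
  from landau_o.big_mult[OF this assms(2)] show ?thesis by simp
qed

lemma linear_bigo:
  fixes D :: "real ^ 'n \<Rightarrow> real ^ 'n"
  assumes "linear D" shows "(\<lambda>y. D (y - P y) $ i) \<in> O[nhds ys](defect)"
proof -
  obtain B where B: "\<And>v. norm (D v) \<le> B * norm v" using linear_bounded[OF assms] by blast
  show ?thesis
    by (rule bigoI[of _ B], rule always_eventually)
       (metis B defect_def abs_norm_cancel component_le_norm_cart order_trans real_norm_def)
qed

lemma expands_smallo:
  assumes "expands f D" shows "(\<lambda>y. f y $ i - P y $ i - D (y - P y) $ i) \<in> o[nhds ys](defect)"
  using assms by (simp add: expands_def)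

lemma expands_bigo:
  assumes "expands f D" shows "(\<lambda>y. f y $ i - P y $ i) \<in> O[nhds ys](defect)"
proof -
  have "(\<lambda>y. (f y $ i - P y $ i - D (y - P y) $ i) + D (y - P y) $ i) \<in> O[nhds ys](defect)"
    using assms by (intro sum_in_bigo(1)[OF landau_o.small_imp_big linear_bigo]) (auto simp: expands_def)
  then show ?thesis by simp
qed

lemma expands_tendsto:
  assumes "expands f D" shows "((\<lambda>y. f y $ i) \<longlongrightarrow> ys $ i) (nhds ys)"
  using tendsto_add[OF bigo_defect_tendsto[OF expands_bigo[OF assms, of i]] tendsto_P_nth[of i]] by simp

lemma expands_pos:
  assumes "expands f D" shows "eventually (\<lambda>y. 0 < f y $ i) (nhds ys)"
  using expands_tendsto[OF assms] pos by (rule order_tendstoD(1))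

lemma expands_id: "expands (\<lambda>y. y) (\<lambda>w. w)"
  by (simp add: expands_def linear_id[unfolded id_def])

text \<open>The components of \<open>P y\<close> stay away from zero near \<open>ys\<close>.\<close>

lemma bigo_cancel_P:
  assumes "(\<lambda>y. P y $ i * k y) \<in> O[nhds ys](defect)" shows "k \<in> O[nhds ys](defect)"
proof -
  have "((\<lambda>y. inverse (P y $ i)) \<longlongrightarrow> inverse (ys $ i)) (nhds ys)"
    using pos[of i] by (intro tendsto_intros tendsto_P_nth) auto
  from bounded_mult_bigo[OF this assms]
  have "(\<lambda>y. inverse (P y $ i) * (P y $ i * k y)) \<in> O[nhds ys](defect)" .
  moreover have "eventually (\<lambda>y. inverse (P y $ i) * (P y $ i * k y) = k y) (nhds ys)"
    using order_tendstoD(1)[OF tendsto_P_nth[of i] pos] by eventually_elim simp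
  ultimately show ?thesis by (rule landau_o.big.in_cong[THEN iffD1, rotated])
qed

text \<open>The factor \<open>P y $ i\<close> is the one that occurs in the linearized stage equation; multiplying by it removes
the denominators from the linear part.\<close>

lemma ratio_expansion:
  assumes f: "expands f D" and h: "expands h E"
  shows "(\<lambda>y. P y $ i * (f y $ i / h y $ i - 1) - (D (y - P y) $ i - E (y - P y) $ i)) \<in> o[nhds ys](defect)"
proof -
  let ?u = "\<lambda>y. f y $ i - P y $ i" and ?v = "\<lambda>y. h y $ i - P y $ i"
  have "((\<lambda>y. ?v y / h y $ i) \<longlongrightarrow> 0 / ys $ i) (nhds ys)"
    using pos[of i]
    by (intro tendsto_divide bigo_defect_tendsto[OF expands_bigo[OF h]] expands_tendsto[OF h]) simp
  then have "(\<lambda>y. ?v y / h y $ i * (?u y - ?v y)) \<in> o[nhds ys](defect)"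
    by (intro tendsto_0_mult_bigo sum_in_bigo(2) expands_bigo[OF f] expands_bigo[OF h]) simp
  then have "(\<lambda>y. (?u y - D (y - P y) $ i) - (?v y - E (y - P y) $ i) - ?v y / h y $ i * (?u y - ?v y))
      \<in> o[nhds ys](defect)"
    by (rule sum_in_smallo(2)[OF sum_in_smallo(2)[OF expands_smallo[OF f] expands_smallo[OF h]]])
  moreover have "eventually (\<lambda>y. (?u y - D (y - P y) $ i) - (?v y - E (y - P y) $ i)
        - ?v y / h y $ i * (?u y - ?v y)
      = P y $ i * (f y $ i / h y $ i - 1) - (D (y - P y) $ i - E (y - P y) $ i)) (nhds ys)"
    using expands_pos[OF h, of i] by eventually_elim (simp add: field_simps)
  ultimately show ?thesis by (rule landau_o.small.in_cong[THEN iffD1, rotated])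
qed

text \<open>For positive arguments the weight depends only on the ratio \<open>r = f y $ i / y $ i\<close>, through
\<open>\<psi> r = r powr (- 1 / p) * (a + b * r)\<close>. Since \<open>\<psi> 1 = a + b\<close> and \<open>\<psi>' 1 = b - (a + b) / p\<close>, the expansion of
the ratio carries over.\<close>

lemma powr_weight_expansion:
  assumes f: "expands f D"
  shows "(\<lambda>y. P y $ i * (f y $ i powr (- 1 / p) * y $ i powr (1 / p - 1) * (a * y $ i + b * f y $ i) - (a + b))
      - (b - (a + b) / p) * (D (y - P y) $ i - (y - P y) $ i)) \<in> o[nhds ys](defect)"
proof -
  define \<psi> where "\<psi> r = r powr (- 1 / p) * (a + b * r)" for r :: real
  define s where "s = b - (a + b) / p"
  define h where "h y = f y $ i / y $ i - 1" for y :: "real ^ 'n"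
  have "(\<psi> has_real_derivative s) (at 1)"
    unfolding \<psi>_def[abs_def] s_def by (auto intro!: derivative_eq_intros)
  then have rem: "(\<lambda>t. \<psi> (1 + t) - \<psi> 1 - s * t) \<in> o[nhds 0](\<lambda>t. t)"
    by (rule derivative_remainder_smallo)
  have ratio: "(\<lambda>y. P y $ i * h y - (D (y - P y) $ i - (y - P y) $ i)) \<in> o[nhds ys](defect)"
    unfolding h_def by (rule ratio_expansion[OF f expands_id])
  have "linear D" using f by (simp add: expands_def)
  then have "(\<lambda>y. (P y $ i * h y - (D (y - P y) $ i - (y - P y) $ i)) + (D (y - P y) $ i - (y - P y) $ i)) \<in> O[nhds ys](defect)"
    by (rule sum_in_bigo(1)[OF landau_o.small_imp_big[OF ratio] sum_in_bigo(2)[OF linear_bigo linear_bigo[OF linear_id[unfolded id_def]]]])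
  then have "(\<lambda>y. P y $ i * h y) \<in> O[nhds ys](defect)" by simp
  then have h: "h \<in> O[nhds ys](defect)" by (rule bigo_cancel_P)
  have "(\<lambda>y. \<psi> (1 + h y) - \<psi> 1 - s * h y) \<in> o[nhds ys](h)"
    using landau_o.small.compose[OF rem bigo_defect_tendsto[OF h]] by simp
  then have "(\<lambda>y. \<psi> (1 + h y) - \<psi> 1 - s * h y) \<in> o[nhds ys](defect)"
    using h by (rule landau_o.small_big_trans)
  then have "(\<lambda>y. P y $ i * (\<psi> (1 + h y) - \<psi> 1 - s * h y)
      + s * (P y $ i * h y - (D (y - P y) $ i - (y - P y) $ i))) \<in> o[nhds ys](defect)"
    using ratio by (intro sum_in_smallo(1)[OF bounded_mult_smallo[OF tendsto_P_nth]]) simp_all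
  moreover have "eventually (\<lambda>y. P y $ i * (\<psi> (1 + h y) - \<psi> 1 - s * h y)
      + s * (P y $ i * h y - (D (y - P y) $ i - (y - P y) $ i)) =
      P y $ i * (f y $ i powr (- 1 / p) * y $ i powr (1 / p - 1) * (a * y $ i + b * f y $ i) - (a + b))
      - s * (D (y - P y) $ i - (y - P y) $ i)) (nhds ys)"
    using expands_pos[OF f, of i] expands_pos[OF expands_id, of i]
  proof eventually_elim
    case (elim y)
    have "(f y $ i / y $ i) powr (- 1 / p) = f y $ i powr (- 1 / p) * y $ i powr (1 / p)"
      using elim by (simp add: powr_divide powr_minus_divide)
    moreover have "y $ i powr (1 / p) = y $ i powr (1 / p - 1) * y $ i"
      using elim by (simp add: powr_diff)
    ultimately have "\<psi> (1 + h y) = f y $ i powr (- 1 / p) * y $ i powr (1 / p - 1) * (a * y $ i + b * f y $ i)"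
      using elim by (simp add: \<psi>_def h_def field_simps)
    then show ?case by (simp add: \<psi>_def algebra_simps)
  qed
  ultimately show ?thesis
    unfolding s_def by (rule landau_o.small.in_cong[THEN iffD1, rotated])
qed

text \<open>Write \<open>c = c0 + e\<close> and \<open>d = stage X y c - P y\<close>. As \<open>X\<close> annihilates \<open>P y\<close>, the stage equation becomes
\<open>d - c0 X d = (y - P y) + X (P y \<circ> e) + X (d \<circ> e)\<close> with componentwise products. The resolvent is
bounded below, so for small \<open>e\<close> the system is uniquely solvable and \<open>d = O(defect)\<close>. Then \<open>X (d \<circ> e)\<close>
is negligible and \<open>P y \<circ> e\<close> may be replaced by its linear part \<open>L\<close>.\<close>

lemma stage_expansion:
  assumes c0: "0 \<le> c0" and L: "linear L" and D: "linear D"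
    and c: "\<And>i. (\<lambda>y. P y $ i * (c y $ i - c0) - L (y - P y) $ i) \<in> o[nhds ys](defect)"
    and lin: "\<And>w. D w - c0 *\<^sub>R (X *v D w) = w + X *v L w"
  shows "expands (\<lambda>y. stage X y (c y)) D"
    and "eventually (\<lambda>y. stage X y (c y) = y + X *v (\<chi> i. stage X y (c y) $ i * c y $ i)) (nhds ys)"
proof -
  let ?x = "\<lambda>y. stage X y (c y)"
  define e where "e y = (\<chi> i. c y $ i - c0)" for y
  define \<pi> where "\<pi> y = (\<chi> i. P y $ i * e y $ i)" for y
  have linR: "linear (\<lambda>v. v - c0 *\<^sub>R (X *v v))"
    by (intro linear_compose_sub linear_id[unfolded id_def] linear_compose_scale_right) simp
  obtain \<kappa> where \<kappa>: "\<kappa> > 0" "\<And>v. \<kappa> * norm v \<le> norm (v - c0 *\<^sub>R (X *v v))"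
    using linear_inj_bounded_below_pos[OF linR inj_resolvent[OF c0]] by metis
  obtain B where B: "B > 0" "\<And>v. norm (X *v v) \<le> B * norm v"
    using linear_bounded_pos[OF matrix_vector_mul_linear] by metis
  have "(\<lambda>y. (P y $ i * e y $ i - L (y - P y) $ i) + L (y - P y) $ i) \<in> O[nhds ys](defect)" for i
    using sum_in_bigo(1)[OF landau_o.small_imp_big[OF c[of i]] linear_bigo[OF L, of i]] by (simp only: e_def vec_lambda_beta)
  then have Pe: "(\<lambda>y. P y $ i * e y $ i) \<in> O[nhds ys](defect)" for i by simp
  then have e: "(\<lambda>y. norm (e y)) \<in> O[nhds ys](defect)"
    by (rule norm_bigo_vec[OF bigo_cancel_P])
  have e0: "((\<lambda>y. norm (e y)) \<longlongrightarrow> 0) (nhds ys)" by (rule bigo_defect_tendsto[OF e])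
  have small: "eventually (\<lambda>y. B * norm (e y) < \<kappa> / 2) (nhds ys)"
  proof -
    have "((\<lambda>y. B * norm (e y)) \<longlongrightarrow> B * 0) (nhds ys)" by (intro tendsto_intros e0)
    then show ?thesis using \<kappa> by (intro order_tendstoD(2)) auto
  qed
  have split: "X *v (\<chi> i. x $ i * c y $ i) = c0 *\<^sub>R (X *v x) + X *v (\<chi> i. x $ i * e y $ i)" for x y
  proof -
    have "(\<chi> i. x $ i * c y $ i) = c0 *\<^sub>R x + (\<chi> i. x $ i * e y $ i)"
      by (simp add: vec_eq_iff e_def algebra_simps)
    then show ?thesis by (simp add: matrix_vector_right_distrib matrix_vector_mult_scaleR)
  qed
  have Xe: "norm (X *v (\<chi> i. x $ i * e y $ i)) \<le> B * norm (e y) * norm x" for x y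
    using B(2)[of "\<chi> i. x $ i * e y $ i"] norm_hadamard_le[of x "e y"] B(1)
    by (smt (verit, best) mult.assoc mult.commute mult_left_mono)
  have ex: "\<exists>!x. x = y + X *v (\<chi> i. x $ i * c y $ i)" if y: "B * norm (e y) < \<kappa> / 2" for y
  proof -
    let ?T = "\<lambda>x. x - X *v (\<chi> i. x $ i * c y $ i)"
    have linT: "linear ?T"
    proof (rule linearI)
      fix a b :: "real ^ 'n" and r :: real
      have "(\<chi> i. (a + b) $ i * c y $ i) = (\<chi> i. a $ i * c y $ i) + (\<chi> i. b $ i * c y $ i)"
        by (simp add: vec_eq_iff algebra_simps)
      then show "?T (a + b) = ?T a + ?T b" by (simp add: matrix_vector_right_distrib)
      have "(\<chi> i. (r *\<^sub>R a) $ i * c y $ i) = r *\<^sub>R (\<chi> i. a $ i * c y $ i)"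
        by (simp add: vec_eq_iff)
      then show "?T (r *\<^sub>R a) = r *\<^sub>R ?T a"
        by (simp add: matrix_vector_mult_scaleR scaleR_diff_right)
    qed
    have injT: "inj ?T"
      unfolding linear_injective_0[OF linT]
    proof safe
      fix v assume "?T v = 0"
      then have "v - c0 *\<^sub>R (X *v v) = X *v (\<chi> i. v $ i * e y $ i)" by (simp add: split algebra_simps)
      then have "\<kappa> * norm v \<le> B * norm (e y) * norm v" using \<kappa>(2)[of v] Xe[of v y] by simp
      also have "\<dots> \<le> \<kappa> / 2 * norm v" using y by (intro mult_right_mono) auto
      finally show "v = 0" using \<kappa>(1) by simp
    qed
    then have "surj ?T" using linT linear_injective_imp_surjective by blast
    then obtain x where "y = ?T x" by (rule surjE)
    then have x: "?T x = y" ..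
    show ?thesis
    proof (rule ex1I[of _ x])
      show "x = y + X *v (\<chi> i. x $ i * c y $ i)" using x by (rule diff_eq_eq[THEN iffD1])
      fix x' assume "x' = y + X *v (\<chi> i. x' $ i * c y $ i)"
      then have "?T x' = ?T x" unfolding x by (rule diff_eq_eq[THEN iffD2])
      then show "x' = x" by (rule injD[OF injT])
    qed
  qed
  show sol: "eventually (\<lambda>y. ?x y = y + X *v (\<chi> i. ?x y $ i * c y $ i)) (nhds ys)"
    using small
  proof eventually_elim
    case (elim y)
    show ?case unfolding stage_def by (rule theI'[OF ex[OF elim]])
  qed
  have eq: "eventually (\<lambda>y. (?x y - P y) - c0 *\<^sub>R (X *v (?x y - P y)) =
      (y - P y) + X *v \<pi> y + X *v (\<chi> i. (?x y - P y) $ i * e y $ i)) (nhds ys)"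
    using sol
  proof eventually_elim
    case (elim y)
    have "(\<chi> i. (?x y - P y) $ i * e y $ i) = (\<chi> i. ?x y $ i * e y $ i) - \<pi> y"
      by (simp add: vec_eq_iff \<pi>_def algebra_simps)
    then have "(?x y - P y) - c0 *\<^sub>R (X *v (?x y - P y)) - ((y - P y) + X *v \<pi> y + X *v (\<chi> i. (?x y - P y) $ i * e y $ i))
        = ?x y - (y + (c0 *\<^sub>R (X *v ?x y) + X *v (\<chi> i. ?x y $ i * e y $ i)))"
      by (simp add: matrix_vector_mult_diff_distrib)
    also have "\<dots> = 0" using elim unfolding split by (rule right_minus_eq[THEN iffD2])
    finally show ?case by (rule right_minus_eq[THEN iffD1])
  qed
  have \<pi>O: "(\<lambda>y. norm (\<pi> y)) \<in> O[nhds ys](defect)"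
    using Pe by (intro norm_bigo_vec) (simp add: \<pi>_def)
  have \<pi>o: "(\<lambda>y. norm (\<pi> y - L (y - P y))) \<in> o[nhds ys](defect)"
    using c by (intro norm_smallo_vec) (simp add: \<pi>_def e_def)
  have dO: "(\<lambda>y. norm (?x y - P y)) \<in> O[nhds ys](defect)"
  proof -
    have "(\<lambda>y. norm (?x y - P y)) \<in> O[nhds ys](\<lambda>y. 2 / \<kappa> * (defect y + B * norm (\<pi> y)))"
    proof (rule bigoI[of _ 1])
      show "\<forall>\<^sub>F y in nhds ys. norm (norm (?x y - P y)) \<le> 1 * norm (2 / \<kappa> * (defect y + B * norm (\<pi> y)))"
        using eq small
      proof eventually_elim
        case (elim y)
        let ?d = "?x y - P y"
        have "\<kappa> * norm ?d \<le> norm ((y - P y) + X *v \<pi> y + X *v (\<chi> i. ?d $ i * e y $ i))"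
          using \<kappa>(2)[of ?d] elim(1) by simp
        also have "\<dots> \<le> defect y + B * norm (\<pi> y) + B * norm (e y) * norm ?d"
          unfolding defect_def by (intro norm_triangle_mono order_refl B Xe)
        also have "B * norm (e y) * norm ?d \<le> \<kappa> / 2 * norm ?d"
          using elim by (intro mult_right_mono) auto
        finally have "norm ?d \<le> 2 / \<kappa> * (defect y + B * norm (\<pi> y))" using \<kappa>(1) by (simp add: field_simps)
        then show ?case by (simp only: real_norm_def abs_norm_cancel mult_1)
      qed
    qed
    also have "(\<lambda>y. 2 / \<kappa> * (defect y + B * norm (\<pi> y))) \<in> O[nhds ys](defect)"
      using \<pi>O \<kappa>(1) by (simp add: sum_in_bigo)
    finally show ?thesis .
  qed
  have "(\<lambda>y. norm (?x y - P y - D (y - P y))) \<in> o[nhds ys](defect)"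
  proof -
    have "(\<lambda>y. norm (?x y - P y - D (y - P y))) \<in>
        O[nhds ys](\<lambda>y. B / \<kappa> * (norm (\<pi> y - L (y - P y)) + norm (e y) * norm (?x y - P y)))"
    proof (rule bigoI[of _ 1])
      show "\<forall>\<^sub>F y in nhds ys. norm (norm (?x y - P y - D (y - P y))) \<le>
          1 * norm (B / \<kappa> * (norm (\<pi> y - L (y - P y)) + norm (e y) * norm (?x y - P y)))"
        using eq
      proof eventually_elim
        case (elim y)
        let ?d = "?x y - P y" and ?w = "y - P y"
        have "(?d - D ?w) - c0 *\<^sub>R (X *v (?d - D ?w)) =
            (?d - c0 *\<^sub>R (X *v ?d)) - (D ?w - c0 *\<^sub>R (X *v D ?w))"
          by (simp only: matrix_vector_mult_diff_distrib scaleR_diff_right) (simp add: algebra_simps)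
        also have "\<dots> = X *v (\<pi> y - L ?w) + X *v (\<chi> i. ?d $ i * e y $ i)"
          unfolding elim lin by (simp only: matrix_vector_mult_diff_distrib) (simp add: algebra_simps)
        finally have "\<kappa> * norm (?d - D ?w) \<le> norm (X *v (\<pi> y - L ?w) + X *v (\<chi> i. ?d $ i * e y $ i))"
          using \<kappa>(2)[of "?d - D ?w"] by simp
        also have "\<dots> \<le> B * norm (\<pi> y - L ?w) + B * norm (e y) * norm ?d"
          by (intro norm_triangle_mono B Xe)
        finally have "norm (?d - D ?w) \<le> B / \<kappa> * (norm (\<pi> y - L ?w) + norm (e y) * norm ?d)"
          using \<kappa>(1) by (simp add: field_simps)
        then show ?case by (simp only: real_norm_def abs_norm_cancel mult_1)
      qed
    qed
    also have "(\<lambda>y. B / \<kappa> * (norm (\<pi> y - L (y - P y)) + norm (e y) * norm (?x y - P y))) \<in> o[nhds ys](defect)"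
      using sum_in_smallo(1)[OF \<pi>o tendsto_0_mult_bigo[OF e0 dO]] \<kappa>(1) B(1) by simp
    finally show ?thesis .
  qed
  then show "expands ?x D"
    using D nth_smallo_vec[of "\<lambda>y. ?x y - P y - D (y - P y)"] by (simp add: expands_def)
qed

end

section \<open>The stability function\<close>

text \<open>The diagonal matrices of the scheme are multiplied out componentwise, which makes each of the four
linear systems an instance of \<open>stage\<close>.\<close>

definition mprk43_map :: "real \<Rightarrow> real ^ 'n ^ 'n \<Rightarrow> real ^ 'n \<Rightarrow> real ^ 'n" where
  "mprk43_map \<gamma> X y = (let
     p = 4 / 3 * \<gamma>;
     y1 = stage X y (\<chi> i. 2 / 3);
     y2 = stage X y (\<chi> i. y1 $ i powr (- 1 / p) * y $ i powr (1 / p - 1) *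
            ((2 / 3 - 1 / (4 * \<gamma>)) * y $ i + 1 / (4 * \<gamma>) * y1 $ i));
     y3 = stage X y (\<chi> i. y1 $ i powr (- 1 / (2 / 3)) * y $ i powr (1 / (2 / 3) - 1) *
            (1 / 4 * y $ i + 3 / 4 * y1 $ i))
   in stage X y (\<chi> i. y3 $ i powr (- 1) * (1 / 4 * y $ i + (3 / 4 - \<gamma>) * y1 $ i + \<gamma> * y2 $ i)))"

lemma diag_mult_vec: "diag u *v v = (\<chi> i. u $ i * v $ i)"
  by (simp add: vec_eq_iff diag_def matrix_vector_mult_def if_distrib[of "\<lambda>x. x * _"] cong: if_cong)

text \<open>The polynomial \<open>a + b z + c z\<^sup>2 + d z\<^sup>3 + e z\<^sup>4\<close> of the matrix \<open>X\<close>. The linear parts of all stages have the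
common denominator \<open>stability_den\<close>, so each is such a polynomial applied to the inverse of the denominator.\<close>

definition quartic :: "real ^ 'n ^ 'n \<Rightarrow> real \<Rightarrow> real \<Rightarrow> real \<Rightarrow> real \<Rightarrow> real \<Rightarrow> real ^ 'n \<Rightarrow> real ^ 'n" where
  "quartic X a b c d e v = a *\<^sub>R v + b *\<^sub>R (X *v v) + c *\<^sub>R (X *v (X *v v)) + d *\<^sub>R (X *v (X *v (X *v v)))
     + e *\<^sub>R (X *v (X *v (X *v (X *v v))))"

abbreviation stability_num :: "real ^ 'n ^ 'n \<Rightarrow> real ^ 'n \<Rightarrow> real ^ 'n" where
  "stability_num X \<equiv> quartic X 1 (-7/3) (23/18) (7/18) (-5/18)"

abbreviation stability_den :: "real ^ 'n ^ 'n \<Rightarrow> real ^ 'n \<Rightarrow> real ^ 'n" where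
  "stability_den X \<equiv> quartic X 1 (-10/3) (37/9) (-20/9) (4/9)"

lemma linear_quartic: "linear (quartic X a b c d e)"
  by (rule linearI)
     (simp_all add: quartic_def matrix_vector_right_distrib matrix_vector_mult_scaleR algebra_simps)

lemmas quartic_expand = quartic_def matrix_vector_right_distrib matrix_vector_mult_diff_distrib
  matrix_vector_mult_scaleR vec_eq_iff

text \<open>The linearized stage equations, after the substitution \<open>w = Q v\<close> that clears all denominators.
\<open>E1\<close>, \<open>E2\<close>, \<open>E3\<close> are the numerators of the inner stages and \<open>E4\<close> that of the whole step. The parameter cancels from \<open>E4\<close> because \<open>\<gamma> (E2 - E1)\<close> is free of it.\<close>

lemma stage_identities:
  fixes X :: "real ^ 'n ^ 'n" and \<gamma> :: real
  defines "Q \<equiv> stability_den X"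
    and "E1 \<equiv> quartic X 1 (-8/3) (7/3) (-2/3) 0"
    and "E2 \<equiv> quartic X 1 (-8/3) (7/3 - 1 / (6 * \<gamma>)) (-2/3 + 1 / (3 * \<gamma>)) (- 1 / (6 * \<gamma>))"
    and "E3 \<equiv> quartic X 1 (-7/3) (23/18) (7/18) (-1/3)"
    and "E4 \<equiv> stability_num X"
  assumes "\<gamma> \<noteq> 0"
  shows "E1 v - (2 / 3) *\<^sub>R (X *v E1 v) = Q v"
    and "E2 v - (2 / 3) *\<^sub>R (X *v E2 v) = Q v + X *v ((- 1 / (4 * \<gamma>)) *\<^sub>R (E1 v - Q v))"
    and "E3 v - X *v E3 v = Q v + X *v ((- 3 / 4) *\<^sub>R (E1 v - Q v))"
    and "E4 v - X *v E4 v = Q v + X *v ((1 / 4) *\<^sub>R Q v + (3 / 4 - \<gamma>) *\<^sub>R E1 v + \<gamma> *\<^sub>R E2 v - E3 v)"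
  using assms(6) unfolding Q_def E1_def E2_def E3_def E4_def
  by (simp_all add: quartic_expand field_simps)

text \<open>With \<open>s\<^sub>k\<close> for the image of \<open>X\<^sup>k v\<close>, this bounds the numerator of the stability function by its
denominator, both multiplied by \<open>18\<close>. The difference of the two squared norms is a quadratic form in the \<open>s\<^sub>k\<close>, equal to
\<open>- 2 (l\<^sub>1 \<bullet> X l\<^sub>1 + 3 l\<^sub>2 \<bullet> X l\<^sub>2 + 3/25 l\<^sub>3 \<bullet> X l\<^sub>3 + 1862/25 s\<^sub>3 \<bullet> s\<^sub>4) + 27 |s\<^sub>2|\<^sup>2 + 137 |s\<^sub>3|\<^sup>2 + 39 |s\<^sub>4|\<^sup>2\<close>
where \<open>X\<close> stands for the shift \<open>s\<^sub>k \<mapsto> s\<^sub>k\<^sub>+\<^sub>1\<close> and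
\<open>l\<^sub>1 = 18 s\<^sub>0 - 51 s\<^sub>1 + 47 s\<^sub>2 - 13 s\<^sub>3\<close>, \<open>l\<^sub>2 = 3 s\<^sub>1 - 7 s\<^sub>2 + 3 s\<^sub>3\<close>, \<open>l\<^sub>3 = 25 s\<^sub>2 - 11 s\<^sub>3\<close>.
The coefficients of the last three squares are those of the identity on the imaginary axis; the \<open>l\<^sub>k\<close> come from the
\<open>L D L\<^sup>T\<close> factorization of the remaining form, the storage matrix of the
Kalman-Yakubovich-Popov lemma.\<close>

lemma stability_function_certificate:
  fixes s0 s1 s2 s3 s4 :: "'a::real_inner"
  assumes diss: "\<And>a b c d. (a *\<^sub>R s0 + b *\<^sub>R s1 + c *\<^sub>R s2 + d *\<^sub>R s3) \<bullet>
                    (a *\<^sub>R s1 + b *\<^sub>R s2 + c *\<^sub>R s3 + d *\<^sub>R s4) \<le> 0"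
  shows "(norm (18 *\<^sub>R s0 - 42 *\<^sub>R s1 + 23 *\<^sub>R s2 + 7 *\<^sub>R s3 - 5 *\<^sub>R s4))\<^sup>2 + 27 * (norm s2)\<^sup>2
       \<le> (norm (18 *\<^sub>R s0 - 60 *\<^sub>R s1 + 74 *\<^sub>R s2 - 40 *\<^sub>R s3 + 8 *\<^sub>R s4))\<^sup>2"
proof -
  have "0 \<le> s3 \<bullet> s3" "0 \<le> s4 \<bullet> s4" by simp_all
  show ?thesis
    using diss[of 18 "-51" 47 "-13"] diss[of 0 3 "-7" 3] diss[of 0 0 25 "-11"] diss[of 0 0 0 1]
    unfolding power2_norm_eq_inner
    by (simp add: inner_add_left inner_add_right inner_diff_left inner_diff_right
      inner_commute[of s1 s0] inner_commute[of s2 s0] inner_commute[of s3 s0]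
      inner_commute[of s4 s0] inner_commute[of s2 s1] inner_commute[of s3 s1] inner_commute[of s4 s1]
      inner_commute[of s3 s2] inner_commute[of s4 s2] inner_commute[of s4 s3])
      (use \<open>0 \<le> s3 \<bullet> s3\<close> \<open>0 \<le> s4 \<bullet> s4\<close> in linarith)
qed

lemma stability_den_factor:
  "stability_den X = (\<lambda>v. v - 1 *\<^sub>R (X *v v)) \<circ> (\<lambda>v. v - 1 *\<^sub>R (X *v v)) \<circ>
     (\<lambda>v. v - (2 / 3) *\<^sub>R (X *v v)) \<circ> (\<lambda>v. v - (2 / 3) *\<^sub>R (X *v v))"
  by (rule ext, simp only: quartic_def o_def matrix_vector_mult_diff_distrib matrix_vector_mult_scaleR
      scaleR_diff_right scaleR_scaleR)
     (simp add: vec_eq_iff)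

lemma inj_linear_inverse:
  fixes f :: "'a::euclidean_space \<Rightarrow> 'a"
  assumes "linear f" "inj f"
  obtains V where "linear V" "\<And>w. f (V w) = w"
proof -
  have "surj f" using assms linear_injective_imp_surjective by blast
  then obtain V where "linear V" "f \<circ> V = id"
    using linear_surjective_right_inverse[OF assms(1)] by auto
  then show thesis using that by (metis comp_apply id_apply)
qed

context split_generator
begin

lemma inj_stability_den: "inj (stability_den X)"
  unfolding stability_den_factor by (intro inj_compose inj_resolvent) simp_all

text \<open>The surplus \<open>27 |s\<^sub>2|\<^sup>2\<close> of the certificate gives strictness: if \<open>X\<^sup>2 v = 0\<close> then \<open>X v\<close> lies in kernel and
range, so \<open>v\<close> is in the kernel and is fixed by the denominator, which puts it in the range as well.\<close>

lemma stability_function_contracts_range: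
  assumes w: "stability_den X v \<in> range ((*v) X)"
    and nz: "stability_den X v \<noteq> 0"
  shows "norm (scaled (stability_num X v)) < norm (scaled (stability_den X v))"
proof -
  let ?s0 = "scaled v" and ?s1 = "scaled (X *v v)" and ?s2 = "scaled (X *v (X *v v))"
    and ?s3 = "scaled (X *v (X *v (X *v v)))" and ?s4 = "scaled (X *v (X *v (X *v (X *v v))))"
  have "(a *\<^sub>R ?s0 + b *\<^sub>R ?s1 + c *\<^sub>R ?s2 + d *\<^sub>R ?s3) \<bullet>
        (a *\<^sub>R ?s1 + b *\<^sub>R ?s2 + c *\<^sub>R ?s3 + d *\<^sub>R ?s4) \<le> 0" for a b c d
    using dissipative[of "a *\<^sub>R v + b *\<^sub>R (X *v v) + c *\<^sub>R (X *v (X *v v)) + d *\<^sub>R (X *v (X *v (X *v v)))"]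
    by (simp add: scaled_simps matrix_vector_right_distrib matrix_vector_mult_scaleR)
  from stability_function_certificate[OF this]
  have "(norm (18 *\<^sub>R scaled (stability_num X v)))\<^sup>2 + 27 * (norm ?s2)\<^sup>2 \<le> (norm (18 *\<^sub>R scaled (stability_den X v)))\<^sup>2"
    by (simp add: quartic_def scaled_simps scaleR_add_right scaleR_diff_right)
  then have le: "324 * (norm (scaled (stability_num X v)))\<^sup>2 + 27 * (norm ?s2)\<^sup>2 \<le> 324 * (norm (scaled (stability_den X v)))\<^sup>2"
    by (simp add: power_mult_distrib)
  have "?s2 \<noteq> 0"
  proof
    assume "?s2 = 0"
    then have "X *v v = 0" using kernel_Int_range[of "X *v v"] by simp
    then have "stability_den X v = v" "X *v stability_den X v = 0" by (simp_all add: quartic_def)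
    with kernel_Int_range[of "stability_den X v"] w nz show False by simp
  qed
  then have "0 < (norm ?s2)\<^sup>2" by simp
  with le have "(norm (scaled (stability_num X v)))\<^sup>2 < (norm (scaled (stability_den X v)))\<^sup>2" by linarith
  then show ?thesis by (rule power_less_imp_less_base) simp
qed

text \<open>The second and the third stage both have weights of the form of \<open>powr_weight_expansion\<close>, with slopes
\<open>- 1 / (4 \<gamma>)\<close> and \<open>- 3 / 4\<close>; the last stage has a weighted mean of \<open>y\<close>, \<open>y1\<close>, \<open>y2\<close> over \<open>y3\<close>. The linear
parts then solve the equations of \<open>stage_identities\<close>.\<close>

lemma mprk43_map_expansion:
  assumes V: "linear V" "\<And>w. stability_den X (V w) = w" and \<gamma>: "\<gamma> \<noteq> 0"
  shows "expands (mprk43_map \<gamma> X) (\<lambda>w. stability_num X (V w))"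
    and "eventually (\<lambda>y. mprk43_map \<gamma> X y - y \<in> range ((*v) X)) (nhds ys)"
proof -
  define p where "p = 4 / 3 * \<gamma>"
  define D1 where "D1 w = quartic X 1 (-8/3) (7/3) (-2/3) 0 (V w)" for w
  define D2 where "D2 w = quartic X 1 (-8/3) (7/3 - 1 / (6 * \<gamma>)) (-2/3 + 1 / (3 * \<gamma>)) (- 1 / (6 * \<gamma>)) (V w)" for w
  define D3 where "D3 w = quartic X 1 (-7/3) (23/18) (7/18) (-1/3) (V w)" for w
  define D4 where "D4 w = stability_num X (V w)" for w
  have lin: "linear D1" "linear D2" "linear D3" "linear D4"
    unfolding D1_def D2_def D3_def D4_def
    by (rule linear_compose[OF V(1) linear_quartic, unfolded o_def])+
  note ids = stage_identities[OF \<gamma>, of X "V w" for w, unfolded V(2), folded D1_def D2_def D3_def D4_def]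
  define y1 where "y1 y = stage X y (\<chi> i. 2 / 3)" for y
  define c2 where "c2 y = (\<chi> i. y1 y $ i powr (- 1 / p) * y $ i powr (1 / p - 1) *
            ((2 / 3 - 1 / (4 * \<gamma>)) * y $ i + 1 / (4 * \<gamma>) * y1 y $ i))" for y
  define y2 where "y2 y = stage X y (c2 y)" for y
  define c3 where "c3 y = (\<chi> i. y1 y $ i powr (- 1 / (2 / 3)) * y $ i powr (1 / (2 / 3) - 1) *
            (1 / 4 * y $ i + 3 / 4 * y1 y $ i))" for y
  define y3 where "y3 y = stage X y (c3 y)" for y
  define u where "u y = (1 / 4) *\<^sub>R y + (3 / 4 - \<gamma>) *\<^sub>R y1 y + \<gamma> *\<^sub>R y2 y" for y
  define c4 where "c4 y = (\<chi> i. y3 y $ i powr (- 1) * u y $ i)" for y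
  have map: "mprk43_map \<gamma> X y = stage X y (c4 y)" for y
    by (simp add: mprk43_map_def Let_def c4_def u_def y3_def c3_def y2_def c2_def y1_def p_def)
  have lin0: "linear (\<lambda>w :: real ^ 'n. w)" by (rule linear_id[unfolded id_def])
  have linL: "linear (\<lambda>w. a *\<^sub>R (D1 w - w))" for a
    by (intro linear_compose_scale_right linear_compose_sub lin lin0)
  have e1: "expands y1 D1"
    unfolding y1_def
  proof (rule stage_expansion(1)[of "2/3" "\<lambda>w. 0" D1 "\<lambda>y. \<chi> i. 2/3"])
    show "linear (\<lambda>w :: real ^ 'n. 0 :: real ^ 'n)" by (simp add: linear_iff)
  qed (use lin ids(1) in simp_all)
  have e2: "expands y2 D2"
    unfolding y2_def
  proof (rule stage_expansion(1)[of "2/3" "\<lambda>w. (- 1 / (4 * \<gamma>)) *\<^sub>R (D1 w - w)"])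
    fix i
    have slope: "1 / (4 * \<gamma>) - (2 / 3 - 1 / (4 * \<gamma>) + 1 / (4 * \<gamma>)) / p = - 1 / (4 * \<gamma>)"
      using \<gamma> by (simp add: p_def field_simps)
    from powr_weight_expansion[OF e1, of i p "2 / 3 - 1 / (4 * \<gamma>)" "1 / (4 * \<gamma>)"]
    show "(\<lambda>y. P y $ i * (c2 y $ i - 2 / 3) - ((- 1 / (4 * \<gamma>)) *\<^sub>R (D1 (y - P y) - (y - P y))) $ i) \<in> o[nhds ys](defect)"
      unfolding slope by (simp add: c2_def)
  qed (simp, rule linL, rule lin, rule ids)
  have e3: "expands y3 D3"
    unfolding y3_def
  proof (rule stage_expansion(1)[of 1 "\<lambda>w. (- 3 / 4) *\<^sub>R (D1 w - w)"])
    fix i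
    show "(\<lambda>y. P y $ i * (c3 y $ i - 1) - ((- 3 / 4) *\<^sub>R (D1 (y - P y) - (y - P y))) $ i) \<in> o[nhds ys](defect)"
      using powr_weight_expansion[OF e1, of i "2 / 3" "1 / 4" "3 / 4"] by (simp add: c3_def)
  qed (simp, rule linL, rule lin, use ids(3) in simp)
  let ?Du = "\<lambda>w. (1 / 4) *\<^sub>R w + (3 / 4 - \<gamma>) *\<^sub>R D1 w + \<gamma> *\<^sub>R D2 w"
  have lin_u: "linear ?Du"
    by (intro linear_compose_add linear_compose_scale_right lin lin0)
  have eu: "expands u ?Du"
    unfolding expands_def
  proof (intro conjI allI lin_u)
    fix i
    have "(\<lambda>y. (3 / 4 - \<gamma>) * (y1 y $ i - P y $ i - D1 (y - P y) $ i) +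
        \<gamma> * (y2 y $ i - P y $ i - D2 (y - P y) $ i)) \<in> o[nhds ys](defect)"
      by (intro sum_in_smallo(1) bounded_mult_smallo[OF tendsto_const] expands_smallo e1 e2)
    then show "(\<lambda>y. u y $ i - P y $ i - ?Du (y - P y) $ i) \<in> o[nhds ys](defect)"
      by (simp add: u_def algebra_simps)
  qed
  have "linear (\<lambda>w. ?Du w - D3 w)" by (intro linear_compose_sub lin_u lin)
  moreover have "(\<lambda>y. P y $ i * (c4 y $ i - 1) - (?Du (y - P y) - D3 (y - P y)) $ i) \<in> o[nhds ys](defect)" for i
  proof -
    have "eventually (\<lambda>y. P y $ i * (u y $ i / y3 y $ i - 1) - (?Du (y - P y) $ i - D3 (y - P y) $ i) =
        P y $ i * (c4 y $ i - 1) - (?Du (y - P y) - D3 (y - P y)) $ i) (nhds ys)"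
      using expands_pos[OF e3, of i] by eventually_elim (simp add: c4_def powr_minus_divide)
    then show ?thesis
      using ratio_expansion[OF eu e3, of i] by (rule landau_o.small.in_cong[THEN iffD1])
  qed
  moreover have "D4 w - 1 *\<^sub>R (X *v D4 w) = w + X *v (?Du w - D3 w)" for w using ids(4) by simp
  ultimately have *: "expands (\<lambda>y. stage X y (c4 y)) D4"
      "eventually (\<lambda>y. stage X y (c4 y) = y + X *v (\<chi> i. stage X y (c4 y) $ i * c4 y $ i)) (nhds ys)"
    using stage_expansion[of 1 "\<lambda>w. ?Du w - D3 w" D4 c4] lin by auto
  from *(1) show "expands (mprk43_map \<gamma> X) (\<lambda>w. stability_num X (V w))"
    unfolding map[abs_def] D4_def[abs_def] .
  have range: "x - y \<in> range ((*v) X)" if "x = y + X *v v" for x y v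
    using that by simp
  show "eventually (\<lambda>y. mprk43_map \<gamma> X y - y \<in> range ((*v) X)) (nhds ys)"
    unfolding map using *(2) by eventually_elim (rule range)
qed

end

section \<open>Linearized stability relative to a projection\<close>

text \<open>The quotient of the two norms attains its maximum on the unit sphere of \<open>T\<close>.\<close>

lemma uniform_strict_contraction:
  fixes F G :: "'a::euclidean_space \<Rightarrow> 'b::real_normed_vector"
  assumes lin: "linear F" "linear G" and T: "subspace T"
    and less: "\<And>w. w \<in> T \<Longrightarrow> w \<noteq> 0 \<Longrightarrow> norm (F w) < norm (G w)"
  obtains \<rho> where "0 \<le> \<rho>" "\<rho> < 1" "\<And>w. w \<in> T \<Longrightarrow> norm (F w) \<le> \<rho> * norm (G w)"
proof (cases "T \<inter> sphere 0 1 = {}")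
  case True
  have "w = 0" if "w \<in> T" for w
  proof (rule ccontr)
    assume "w \<noteq> 0"
    then have "(1 / norm w) *\<^sub>R w \<in> T \<inter> sphere 0 1" using that T by (simp add: subspace_scale)
    with True show False by blast
  qed
  then show thesis using that[of 0] linear_0[OF lin(1)] by (metis norm_zero mult_zero_left order_refl zero_less_one)
next
  case False
  have "continuous_on (T \<inter> sphere 0 1) (\<lambda>w. norm (F w) / norm (G w))"
    using less by (intro continuous_intros linear_continuous_on_compose[OF _ lin(1)]
      linear_continuous_on_compose[OF _ lin(2)]) fastforce
  moreover have "compact (T \<inter> sphere 0 1)"
    using closed_subspace[OF T] compact_sphere by (rule closed_Int_compact)
  ultimately obtain m where "m \<in> T \<inter> sphere 0 1"
    and "\<forall>w \<in> T \<inter> sphere 0 1. norm (F w) / norm (G w) \<le> norm (F m) / norm (G m)"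
    using continuous_attains_sup[OF _ False] by blast
  then have m: "m \<in> T" "norm m = 1"
    and max: "\<And>w. w \<in> T \<Longrightarrow> norm w = 1 \<Longrightarrow> norm (F w) / norm (G w) \<le> norm (F m) / norm (G m)"
    by auto
  show thesis
  proof (rule that[of "norm (F m) / norm (G m)"])
    have "norm (F m) < norm (G m)" using less[of m] m by force
    then show "norm (F m) / norm (G m) < 1" by (simp add: divide_less_eq)
    fix w assume w: "w \<in> T"
    show "norm (F w) \<le> norm (F m) / norm (G m) * norm (G w)"
    proof (cases "w = 0")
      case True
      then show ?thesis using linear_0[OF lin(1)] linear_0[OF lin(2)] by simp
    next
      case False
      have "norm (F ((1 / norm w) *\<^sub>R w)) / norm (G ((1 / norm w) *\<^sub>R w)) \<le> norm (F m) / norm (G m)"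
        using False w T by (intro max) (simp_all add: subspace_scale)
      then have "norm (F w) / norm (G w) \<le> norm (F m) / norm (G m)"
        using False by (simp add: linear_scale[OF lin(1)] linear_scale[OF lin(2)])
      moreover have "0 < norm (G w)" using less[OF w False] norm_ge_zero[of "F w"] by linarith
      ultimately show ?thesis by (metis pos_divide_le_eq)
    qed
  qed simp
qed

text \<open>Near \<open>ys\<close> the map preserves the fibres of \<open>P\<close> and contracts each of them towards \<open>P y\<close> as measured by \<open>q\<close>.
The orbit of \<open>y0\<close> therefore stays within a constant multiple of \<open>norm (y0 - ys)\<close> from \<open>ys\<close>; for \<open>y0\<close>
close to \<open>ys\<close> it never leaves the neighbourhood where the contraction holds.\<close>

lemma contraction_towards_projection:
  fixes g P :: "'a::real_normed_vector \<Rightarrow> 'a" and q :: "'a \<Rightarrow> real"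
  assumes P: "bounded_linear P" and fixed: "P ys = ys"
    and q: "\<And>v. norm v \<le> C * q v" "\<And>v. q v \<le> C * norm v"
    and rho: "0 \<le> \<rho>" "\<rho> < 1" and C: "0 < C"
    and step: "eventually (\<lambda>y. P (g y) = P y \<and> q (g y - P y) \<le> \<rho> * q (y - P y)) (nhds ys)"
  shows "lyapunov_stable_fixed_point g ys \<and>
    (\<exists>\<delta>>0. \<forall>y0. norm (y0 - ys) < \<delta> \<longrightarrow> (\<lambda>n. (g ^^ n) y0) \<longlonglongrightarrow> P y0)"
proof -
  obtain r where r: "r > 0" and
    loc: "\<And>y. norm (y - ys) < r \<Longrightarrow> P (g y) = P y \<and> q (g y - P y) \<le> \<rho> * q (y - P y)"
    using step unfolding eventually_nhds_metric by (auto simp: dist_norm)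
  obtain K where K: "K > 0" "\<And>v. norm (P v) \<le> norm v * K"
    using bounded_linear.pos_bounded[OF P] by blast
  interpret P: bounded_linear P by (rule P)
  \<comment> \<open>\<open>K\<close> accounts for the displacement of \<open>P y0\<close>, the other term for the distance between orbit and \<open>P y0\<close>.\<close>
  define M where "M = K + C * (C * (1 + K))"
  have M: "M > 0" using K C by (simp add: M_def add_pos_pos)
  have q0: "q v \<ge> 0" for v using q(1)[of v] C by (metis norm_ge_zero order_trans zero_le_mult_iff not_le)
  have gap: "norm (y - P y) \<le> (1 + K) * norm (y - ys)" for y
  proof -
    have "y - P y = (y - ys) - P (y - ys)" by (simp add: P.diff fixed)
    then have "norm (y - P y) \<le> norm (y - ys) + norm (P (y - ys))" by (metis norm_triangle_ineq4)
    then show ?thesis using K(2)[of "y - ys"] by (simp add: algebra_simps)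
  qed
  have near: "norm (y - ys) \<le> M * norm (y0 - ys)"
    if "P y = P y0" "q (y - P y0) \<le> q (y0 - P y0)" for y y0
  proof -
    have "y - ys = (y - P y0) + P (y0 - ys)" by (simp add: P.diff fixed)
    then have "norm (y - ys) \<le> norm (y - P y0) + norm (P (y0 - ys))"
      by (metis norm_triangle_ineq)
    also have "norm (y - P y0) \<le> C * (C * ((1 + K) * norm (y0 - ys)))"
    proof -
      have "norm (y - P y0) \<le> C * q (y0 - P y0)"
        using q(1)[of "y - P y0"] that C by (meson mult_le_cancel_left_pos order_trans)
      also have "\<dots> \<le> C * (C * norm (y0 - P y0))" using q(2) C by simp
      also have "\<dots> \<le> C * (C * ((1 + K) * norm (y0 - ys)))" using gap C by simp
      finally show ?thesis .
    qed
    finally show ?thesis using K(2)[of "y0 - ys"] by (simp add: M_def algebra_simps)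
  qed
  have iter: "P ((g ^^ n) y0) = P y0 \<and> q ((g ^^ n) y0 - P y0) \<le> \<rho> ^ n * q (y0 - P y0) \<and>
      norm ((g ^^ n) y0 - ys) \<le> M * norm (y0 - ys)"
    if y0: "norm (y0 - ys) < r / M" for y0 n
  proof (induction n)
    case 0
    then show ?case using near[of y0 y0] by simp
  next
    case (Suc n)
    let ?y = "(g ^^ n) y0"
    have "norm (?y - ys) < r"
      using Suc y0 M by (smt (verit) mult.commute pos_less_divide_eq)
    from loc[OF this] Suc have a: "P (g ?y) = P y0" and "q (g ?y - P y0) \<le> \<rho> * q (?y - P y0)"
      by auto
    moreover have "\<rho> * q (?y - P y0) \<le> \<rho> * (\<rho> ^ n * q (y0 - P y0))"
      using Suc rho by (intro mult_left_mono) auto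
    ultimately have b: "q (g ?y - P y0) \<le> \<rho> ^ Suc n * q (y0 - P y0)" by (simp add: mult_ac)
    moreover have "\<rho> ^ Suc n * q (y0 - P y0) \<le> 1 * q (y0 - P y0)"
      using rho q0 by (intro mult_right_mono power_le_one) auto
    ultimately show ?case using a near[of "g ?y" y0] by simp
  qed
  have "g ys = ys"
  proof -
    have "P (g ys) = P ys \<and> q (g ys - P ys) \<le> \<rho> * q (ys - P ys)" using loc[of ys] r by simp
    moreover have "q 0 = 0" using q(2)[of 0] q0[of 0] by simp
    ultimately have "q (g ys - ys) \<le> 0" by (simp add: fixed)
    then have "norm (g ys - ys) \<le> 0"
      using q(1)[of "g ys - ys"] q0[of "g ys - ys"] by (simp add: order_antisym)
    then show ?thesis by simp
  qed
  moreover have "\<exists>\<delta>>0. \<forall>y0. norm (y0 - ys) < \<delta> \<longrightarrow> (\<forall>n. norm ((g ^^ n) y0 - ys) < \<epsilon>)"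
    if "\<epsilon> > 0" for \<epsilon>
  proof (intro exI[of _ "min r \<epsilon> / M"] conjI allI impI)
    show "0 < min r \<epsilon> / M" using r that M by simp
    fix y0 n assume y0: "norm (y0 - ys) < min r \<epsilon> / M"
    then have "M * norm (y0 - ys) < min r \<epsilon>" using M by (simp add: pos_less_divide_eq mult.commute)
    moreover have "norm (y0 - ys) < r / M"
      using calculation M by (simp add: pos_less_divide_eq mult.commute)
    ultimately show "norm ((g ^^ n) y0 - ys) < \<epsilon>" using iter[of y0 n] by simp
  qed
  moreover have "(\<lambda>n. (g ^^ n) y0) \<longlonglongrightarrow> P y0" if "norm (y0 - ys) < r / M" for y0
  proof -
    have "(\<lambda>n. C * (\<rho> ^ n * q (y0 - P y0))) \<longlonglongrightarrow> C * (0 * q (y0 - P y0))"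
      using rho by (intro tendsto_intros LIMSEQ_realpow_zero) auto
    then have "(\<lambda>n. C * (\<rho> ^ n * q (y0 - P y0))) \<longlonglongrightarrow> 0" by simp
    moreover have "norm ((g ^^ n) y0 - P y0) \<le> C * (\<rho> ^ n * q (y0 - P y0))" for n
      using q(1)[of "(g ^^ n) y0 - P y0"] iter[OF that, of n] C
      by (smt (verit) mult_left_mono)
    ultimately have "(\<lambda>n. (g ^^ n) y0 - P y0) \<longlonglongrightarrow> 0"
      by (rule Lim_null_comparison[OF always_eventually, OF allI, rotated])
    then show ?thesis by (rule LIM_zero_cancel)
  qed
  moreover have "r / M > 0" using r M by simp
  ultimately show ?thesis unfolding lyapunov_stable_fixed_point_def by blast
qed

context split_generator
begin

lemma mprk43_map_stable_convergent:
  assumes \<gamma>: "\<gamma> \<noteq> 0"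
  shows "lyapunov_stable_fixed_point (mprk43_map \<gamma> X) ys \<and>
    (\<exists>\<delta>>0. \<forall>y0. norm (y0 - ys) < \<delta> \<longrightarrow> (\<lambda>n. (mprk43_map \<gamma> X ^^ n) y0) \<longlonglongrightarrow> P y0)"
proof -
  let ?g = "mprk43_map \<gamma> X" and ?Q = "stability_den X"
  obtain V where V: "linear V" "\<And>w. ?Q (V w) = w"
    using inj_linear_inverse[OF linear_quartic inj_stability_den] by metis
  define D where "D w = stability_num X (V w)" for w
  have g: "expands ?g D"
    using mprk43_map_expansion(1)[OF V \<gamma>] by (simp add: D_def[abs_def])
  have "norm (scaled (D w)) < norm (scaled w)" if "w \<in> range ((*v) X)" "w \<noteq> 0" for w
    using stability_function_contracts_range[of "V w", unfolded V(2)] that unfolding D_def by blast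
  moreover have "linear (\<lambda>w. scaled (D w))"
    using g linear_compose[OF _ linear_scaled] by (auto simp: expands_def o_def)
  moreover have "subspace (range ((*v) X))" by (simp add: linear_subspace_image)
  ultimately obtain \<rho> where \<rho>: "0 \<le> \<rho>" "\<rho> < 1"
    and D: "\<And>w. w \<in> range ((*v) X) \<Longrightarrow> norm (scaled (D w)) \<le> \<rho> * norm (scaled w)"
    using uniform_strict_contraction[of "\<lambda>w. scaled (D w)" scaled] linear_scaled by metis
  obtain C where C: "0 < C" "\<And>v. norm v \<le> C * norm (scaled v)" "\<And>v. norm (scaled v) \<le> C * norm v"
    using scaled_bounds by metis
  \<comment> \<open>Small enough to worsen the rate \<open>\<rho>\<close> only to \<open>(1 + \<rho>) / 2\<close> after two changes of norm.\<close>
  define \<epsilon> where "\<epsilon> = (1 - \<rho>) / (2 * (C * C))"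
  have "\<epsilon> > 0" using \<rho> C(1) by (simp add: \<epsilon>_def)
  have "(\<lambda>y. norm (?g y - P y - D (y - P y))) \<in> o[nhds ys](defect)"
    using expands_smallo[OF g] by (intro norm_smallo_vec) simp
  from landau_o.smallD[OF this \<open>\<epsilon> > 0\<close>]
  have small: "\<forall>\<^sub>F y in nhds ys. norm (?g y - P y - D (y - P y)) \<le> \<epsilon> * norm (y - P y)"
    by (simp add: defect_def)
  have "\<forall>\<^sub>F y in nhds ys. P (?g y) = P y \<and> norm (scaled (?g y - P y)) \<le> (1 + \<rho>) / 2 * norm (scaled (y - P y))"
    using small mprk43_map_expansion(2)[OF V \<gamma>]
  proof eventually_elim
    case (elim y)
    let ?w = "y - P y" and ?r = "?g y - P y - D (y - P y)"
    have "P (?g y - y) = 0" using elim(2) P_X by auto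
    then have "P (?g y) = P y" by (simp add: linear_diff[OF linear_P])
    have "scaled (?g y - P y) = scaled (D ?w) + scaled ?r" by (simp flip: scaled_simps)
    then have "norm (scaled (?g y - P y)) \<le> norm (scaled (D ?w)) + norm (scaled ?r)" by (metis norm_triangle_ineq)
    also have "\<dots> \<le> \<rho> * norm (scaled ?w) + (1 - \<rho>) / 2 * norm (scaled ?w)"
    proof (rule add_mono)
      show "norm (scaled (D ?w)) \<le> \<rho> * norm (scaled ?w)" by (rule D[OF P_range])
      have "norm (scaled ?r) \<le> C * (\<epsilon> * (C * norm (scaled ?w)))"
        using C(3)[of ?r] elim(1) C(2)[of ?w] C(1) \<open>\<epsilon> > 0\<close>
        by (smt (verit, best) mult_left_mono)
      also have "\<dots> = (1 - \<rho>) / 2 * norm (scaled ?w)" using C(1) by (simp add: \<epsilon>_def)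
      finally show "norm (scaled ?r) \<le> (1 - \<rho>) / 2 * norm (scaled ?w)" .
    qed
    also have "\<dots> = (1 + \<rho>) / 2 * norm (scaled ?w)" by (simp add: field_simps)
    finally show ?case using \<open>P (?g y) = P y\<close> by simp
  qed
  then show ?thesis
    using C \<rho> linear_P P_ys
    by (intro contraction_towards_projection[where q = "\<lambda>v. norm (scaled v)" and C = C and \<rho> = "(1 + \<rho>) / 2"])
       (auto simp: linear_conv_bounded_linear)
qed

text \<open>A kernel vector \<open>k\<close>, divided componentwise by \<open>ys\<close>, is a linear invariant \<open>n\<close> by orthogonality of kernel
and range. Applied to \<open>k = P y - z\<close>, conservation of \<open>n\<close> says that \<open>k\<close> has weighted norm zero.\<close>

lemma P_steady_state:
  assumes z: "X *v z = 0" and cons: "\<And>n. transpose X *v n = 0 \<Longrightarrow> n \<bullet> z = n \<bullet> y"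
  shows "P y = z"
proof -
  define k where "k = P y - z"
  define n where "n = (\<chi> i. k $ i / ys $ i)"
  have Xk: "X *v k = 0" by (simp add: k_def matrix_vector_mult_diff_distrib z)
  have n: "n \<bullet> x = scaled k \<bullet> scaled x" for x
    using pos by (simp add: n_def scaled_def inner_vec_def less_imp_le)
  have "transpose X *v n = 0"
  proof -
    have "(transpose X *v n) \<bullet> x = 0" for x
      using kernel_orthogonal_range[OF Xk, of x] by (simp add: transpose_matrix_vector dot_lmul_matrix n)
    then show ?thesis using inner_eq_zero_iff by blast
  qed
  then have "n \<bullet> z = n \<bullet> y" by (rule cons)
  moreover have "n \<bullet> (y - P y) = 0" using P_range[of y] kernel_orthogonal_range[OF Xk] n by auto
  ultimately have "n \<bullet> k = 0" by (simp add: k_def inner_diff_right)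
  then have "k = 0" by (simp add: n)
  then show ?thesis by (simp add: k_def)
qed

end

text \<open>The step size enters only through the product \<open>dt A\<close>.\<close>

lemma mprk43_scaled:
  fixes A :: "real ^ 'n ^ 'n"
  shows "mprk43 \<gamma> dt A = mprk43_map \<gamma> (dt *\<^sub>R A)"
proof -
  have s: "dt *\<^sub>R (A *v (u :: real ^ 'n)) = (dt *\<^sub>R A) *v u" for u by (simp add: scaleR_matrix_vector_assoc)
  have s1: "(a * dt) *\<^sub>R (A *v (x :: real ^ 'n)) = (dt *\<^sub>R A) *v (\<chi> i. x $ i * a)" for a x
  proof -
    have "(\<chi> i. x $ i * a) = a *\<^sub>R x" by (simp add: vec_eq_iff)
    then show ?thesis by (simp add: s[symmetric] matrix_vector_mult_scaleR mult.commute)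
  qed
  have s2: "dt *\<^sub>R ((A ** diag x ** diag_powr a r ** diag_powr b t) *v u) =
      (dt *\<^sub>R A) *v (\<chi> i. x $ i * (a $ i powr r * b $ i powr t * u $ i))" for x a b u r t
    by (simp add: s diag_powr_def diag_mult_vec mult_ac flip: matrix_vector_mul_assoc)
  have s3: "dt *\<^sub>R ((A ** diag x ** diag_powr a (- 1)) *v u) =
      (dt *\<^sub>R A) *v (\<chi> i. x $ i * (a $ i powr (- 1) * u $ i))" for x a u
    by (simp add: s diag_powr_def diag_mult_vec flip: matrix_vector_mul_assoc)
  show ?thesis
    unfolding mprk43_def mprk43_map_def Let_def stage_def s1 s2 s3 by simp
qed

theorem corollary3p8:
  fixes A :: "real ^ 'n ^ 'n" and \<gamma> :: real
  assumes "standing_assumptions A"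
    and "3 / 8 \<le> \<gamma>" and "\<gamma> \<le> 3 / 4"
  shows "(\<forall>ystar. positive_vec ystar \<and> A *v ystar = 0 \<longrightarrow>
            (\<forall>dt>0. lyapunov_stable_fixed_point (mprk43 \<gamma> dt A) ystar)) \<and>
         (\<forall>ystar. positive_vec ystar \<longrightarrow>
            (\<forall>dt>0. \<exists>\<delta>>0. \<forall>y0. positive_vec y0 \<and> ivp_steady_state A y0 ystar \<and>
               norm (y0 - ystar) < \<delta> \<longrightarrow>
               (\<lambda>n. (mprk43 \<gamma> dt A ^^ n) y0) \<longlonglongrightarrow> ystar))"
proof -
  have key: "lyapunov_stable_fixed_point (mprk43 \<gamma> dt A) ystar \<and>
      (\<exists>\<delta>>0. \<forall>y0. ivp_steady_state A y0 ystar \<and> norm (y0 - ystar) < \<delta> \<longrightarrow>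
         (\<lambda>n. (mprk43 \<gamma> dt A ^^ n) y0) \<longlonglongrightarrow> ystar)"
    if ystar: "positive_vec ystar" "A *v ystar = 0" and dt: "0 < dt" for ystar and dt :: real
  proof -
    have ones: "transpose A *v 1 = 0" and offdiag: "\<And>i j. i \<noteq> j \<Longrightarrow> 0 \<le> A $ i $ j"
      using assms(1) by (auto simp: standing_assumptions_def)
    have "(\<Sum>i\<in>UNIV. A $ i $ j) = (transpose A *v 1) $ j" for j
      by (simp add: matrix_vector_mult_def transpose_def)
    then have colsum: "(\<Sum>i\<in>UNIV. A $ i $ j) = 0" for j using ones by simp
    interpret weighted_generator "dt *\<^sub>R A" ystar
      using ystar dt offdiag colsum
      by unfold_locales
        (auto simp: positive_vec_def scaleR_matrix_vector_assoc[symmetric] simp flip: sum_distrib_left)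
    obtain P where P: "linear P" "\<And>y. (dt *\<^sub>R A) *v P y = 0" "\<And>y. y - P y \<in> range ((*v) (dt *\<^sub>R A))"
      using kernel_projection by metis
    interpret split_generator "dt *\<^sub>R A" ystar P
      by (intro split_generator.intro split_generator_axioms.intro weighted_generator_axioms P)
    have limit: "P y0 = ystar" if "ivp_steady_state A y0 ystar" for y0
    proof (rule P_steady_state[OF equilibrium])
      fix n assume "transpose (dt *\<^sub>R A) *v n = 0"
      moreover have "transpose (dt *\<^sub>R A) *v n = dt *\<^sub>R (transpose A *v n)"
        by (simp add: vec_eq_iff transpose_def matrix_vector_mult_def sum_distrib_left mult_ac)
      ultimately show "n \<bullet> ystar = n \<bullet> y0" using that dt by (simp add: ivp_steady_state_def)
    qed
    have "\<gamma> \<noteq> 0" using assms(2) by simp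
    from mprk43_map_stable_convergent[OF this, folded mprk43_scaled] show ?thesis
      using limit by metis
  qed
  show ?thesis
  proof (intro conjI allI impI)
    fix ystar :: "real ^ 'n" and dt :: real
    assume "positive_vec ystar \<and> A *v ystar = 0" "0 < dt"
    then show "lyapunov_stable_fixed_point (mprk43 \<gamma> dt A) ystar" using key by blast
  next
    fix ystar :: "real ^ 'n" and dt :: real
    assume "positive_vec ystar" "0 < dt"
    then show "\<exists>\<delta>>0. \<forall>y0. positive_vec y0 \<and> ivp_steady_state A y0 ystar \<and> norm (y0 - ystar) < \<delta> \<longrightarrow>
        (\<lambda>n. (mprk43 \<gamma> dt A ^^ n) y0) \<longlonglongrightarrow> ystar"
      \<comment> \<open>If \<open>ystar\<close> is not in the kernel, no \<open>y0\<close> has it as steady state and any \<open>\<delta>\<close> will do.\<close>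
      using key[of ystar dt] by (cases "A *v ystar = 0") (auto simp: ivp_steady_state_def intro: exI[of _ 1])
  qed
qed

end
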